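(* Let $X$ and $Y$ be infinite-dimensional Banach spaces. Suppose that $Y$ contains an isomorphic copy of $c_0$ and that every bounded sequence in $Y^*$ has a weak$^*$-convergent subsequence. Then $K(X,Y)$ contains a complemented copy of $c_0$.
   Context: $K(X,Y)$ denotes the Banach space, with the operator norm, of compact linear operators from $X$ to $Y$; $Y^*$ is the dual of $Y$, and weak$^*$ convergence in $Y^*$ is with respect to $\sigma(Y^*,Y)$. A Banach space $E$ contains an isomorphic copy of a Banach space $F$ if $E$ has a closed subspace that is linearly homeomorphic to $F$; it contains a complemented copy of $F$ if it has such a subspace which is moreover the range of a continuous linear projection defined on $E$. *)

theory Defs
  imports "HOL-Analysis.Analysis"
begin

text \<open>
  Banach spaces are real. Those that do not fill a whole type, such as \<open>c\<^sub>0\<close> and \<open>K(X,Y)\<close>, are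
  linear subspaces of a normed type and carry the inherited norm.
\<close>

definition linear_map_on :: "'a::real_vector set \<Rightarrow> ('a \<Rightarrow> 'b::real_vector) \<Rightarrow> bool" where
  "linear_map_on S f \<longleftrightarrow>
     (\<forall>x\<in>S. \<forall>y\<in>S. f (x + y) = f x + f y) \<and> (\<forall>c. \<forall>x\<in>S. f (c *\<^sub>R x) = c *\<^sub>R f x)"

definition linearly_homeomorphic ::
    "'a::real_normed_vector set \<Rightarrow> 'b::real_normed_vector set \<Rightarrow> bool" where
  "linearly_homeomorphic S T \<longleftrightarrow> (\<exists>f g. linear_map_on S f \<and> homeomorphism S T f g)"

definition contains_copy ::
    "'a::real_normed_vector set \<Rightarrow> 'b::real_normed_vector set \<Rightarrow> bool" where
  "contains_copy E F \<longleftrightarrow>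
     (\<exists>G. subspace G \<and> closedin (top_of_set E) G \<and> linearly_homeomorphic G F)"

definition contains_complemented_copy ::
    "'a::real_normed_vector set \<Rightarrow> 'b::real_normed_vector set \<Rightarrow> bool" where
  "contains_complemented_copy E F \<longleftrightarrow>
     (\<exists>G. subspace G \<and> closedin (top_of_set E) G \<and> linearly_homeomorphic G F \<and>
        (\<exists>P. linear_map_on E P \<and> continuous_on E P \<and> P ` E = G \<and> (\<forall>x\<in>E. P (P x) = P x)))"

text \<open>
  The type \<open>nat\<close> is discrete, so \<open>nat \<Rightarrow>\<^sub>C real\<close> is the space of all bounded real sequences
  with the supremum norm.
\<close>

definition c0 :: "(nat \<Rightarrow>\<^sub>C real) set" where
  "c0 = {x. apply_bcontfun x \<longlonglongrightarrow> 0}"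

lemma subspace_c0: "subspace c0"
proof (rule subspaceI)
  show "0 \<in> c0" by (simp add: c0_def)
  show "x + y \<in> c0" if "x \<in> c0" "y \<in> c0" for x y
    using that tendsto_add[of x 0 sequentially y 0] by (simp add: c0_def plus_bcontfun.rep_eq)
  show "c *\<^sub>R x \<in> c0" if "x \<in> c0" for c x
    using that tendsto_mult[of "\<lambda>_. c" c sequentially x 0]
    by (simp add: c0_def scaleR_bcontfun.rep_eq)
qed

lemma closed_c0: "closed c0"
  unfolding closed_sequential_limits
proof safe
  fix f :: "nat \<Rightarrow> (nat \<Rightarrow>\<^sub>C real)" and l
  assume f: "\<forall>n. f n \<in> c0" and lim: "f \<longlonglongrightarrow> l"
  show "l \<in> c0"
    unfolding c0_def mem_Collect_eq LIMSEQ_iff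
  proof (intro allI impI)
    fix e :: real assume "e > 0"
    then obtain n where n: "dist (f n) l < e / 2"
      using lim by (metis half_gt_zero lim_sequentially order_refl)
    obtain N where N: "norm (f n k - 0) < e / 2" if "k \<ge> N" for k
      using f \<open>e > 0\<close> unfolding c0_def mem_Collect_eq LIMSEQ_iff by (meson half_gt_zero)
    have "norm (l k - 0) < e" if "k \<ge> N" for k
      using N[OF that] dist_bounded[of "f n" k l] n by (simp add: dist_real_def)
    then show "\<exists>N. \<forall>k\<ge>N. norm (l k - 0) < e" by blast
  qed
qed

definition compact_operators ::
    "('a::real_normed_vector \<Rightarrow>\<^sub>L 'b::real_normed_vector) set" where
  "compact_operators = {T. compact (closure (blinfun_apply T ` cball 0 1))}"

lemma compact_operators_totally_bounded_iff:
  fixes T :: "'a::real_normed_vector \<Rightarrow>\<^sub>L 'b::banach"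
  shows "T \<in> compact_operators \<longleftrightarrow>
    (\<forall>e>0. \<exists>k. finite k \<and> blinfun_apply T ` cball 0 1 \<subseteq> (\<Union>x\<in>k. ball x e))"
proof
  assume "T \<in> compact_operators"
  then show "\<forall>e>0. \<exists>k. finite k \<and> blinfun_apply T ` cball 0 1 \<subseteq> (\<Union>x\<in>k. ball x e)"
    unfolding compact_operators_def mem_Collect_eq compact_eq_totally_bounded
    by (meson closure_subset order_trans)
next
  assume tb: "\<forall>e>0. \<exists>k. finite k \<and> blinfun_apply T ` cball 0 1 \<subseteq> (\<Union>x\<in>k. ball x e)"
  have "\<exists>k. finite k \<and> closure (blinfun_apply T ` cball 0 1) \<subseteq> (\<Union>x\<in>k. ball x e)"
    if "e > 0" for e
  proof -
    obtain k where k: "finite k" "blinfun_apply T ` cball 0 1 \<subseteq> (\<Union>x\<in>k. ball x (e/2))"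
      using tb \<open>e > 0\<close> by (meson half_gt_zero)
    then have "blinfun_apply T ` cball 0 1 \<subseteq> (\<Union>x\<in>k. cball x (e/2))"
      using ball_subset_cball by blast
    then have "closure (blinfun_apply T ` cball 0 1) \<subseteq> (\<Union>x\<in>k. cball x (e/2))"
      by (rule closure_minimal) (use k in auto)
    also have "\<dots> \<subseteq> (\<Union>x\<in>k. ball x e)" using \<open>e > 0\<close> by (force simp: dist_commute)
    finally show ?thesis using k by blast
  qed
  then show "T \<in> compact_operators"
    by (simp add: compact_operators_def compact_eq_totally_bounded complete_eq_closed)
qed

lemma subspace_compact_operators:
  "subspace (compact_operators :: ('a::real_normed_vector \<Rightarrow>\<^sub>L 'b::real_normed_vector) set)"
proof (rule subspaceI)
  show "0 \<in> (compact_operators :: ('a \<Rightarrow>\<^sub>L 'b) set)"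
    by (simp add: compact_operators_def zero_blinfun.rep_eq image_constant_conv)
next
  fix S T :: "'a \<Rightarrow>\<^sub>L 'b" assume ST: "S \<in> compact_operators" "T \<in> compact_operators"
  let ?S = "closure (blinfun_apply S ` cball 0 1)" and ?T = "closure (blinfun_apply T ` cball 0 1)"
  have c: "compact {x + y |x y. x \<in> ?S \<and> y \<in> ?T}"
    by (rule compact_sums) (use ST in \<open>simp_all add: compact_operators_def\<close>)
  have "blinfun_apply (S + T) ` cball 0 1 \<subseteq> {x + y |x y. x \<in> ?S \<and> y \<in> ?T}"
  proof (rule image_subsetI)
    fix x :: 'a assume "x \<in> cball 0 1"
    then have "blinfun_apply S x \<in> ?S" "blinfun_apply T x \<in> ?T"
      by (simp_all add: closure_subset[THEN subsetD])
    then show "blinfun_apply (S + T) x \<in> {x + y |x y. x \<in> ?S \<and> y \<in> ?T}"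
      unfolding plus_blinfun.rep_eq by blast
  qed
  then have "closure (blinfun_apply (S + T) ` cball 0 1) \<subseteq> {x + y |x y. x \<in> ?S \<and> y \<in> ?T}"
    by (rule closure_minimal) (rule compact_imp_closed[OF c])
  then show "S + T \<in> compact_operators"
    unfolding compact_operators_def mem_Collect_eq
    using compact_Int_closed[OF c closed_closure, of "blinfun_apply (S + T) ` cball 0 1"]
    by (simp only: inf_absorb2)
next
  fix c :: real and T :: "'a \<Rightarrow>\<^sub>L 'b" assume "T \<in> compact_operators"
  then have c: "compact ((*\<^sub>R) c ` closure (blinfun_apply T ` cball 0 1))"
    by (auto simp: compact_operators_def intro: compact_scaling)
  have "blinfun_apply (c *\<^sub>R T) ` cball 0 1 = (*\<^sub>R) c ` blinfun_apply T ` cball 0 1"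
    by (auto simp: scaleR_blinfun.rep_eq image_image)
  then show "c *\<^sub>R T \<in> compact_operators"
    using c by (simp add: compact_operators_def closure_scaleR)
qed

lemma closed_compact_operators:
  "closed (compact_operators :: ('a::real_normed_vector \<Rightarrow>\<^sub>L 'b::banach) set)"
  unfolding closure_subset_eq[symmetric]
proof
  fix T :: "'a \<Rightarrow>\<^sub>L 'b" assume "T \<in> closure compact_operators"
  then have T: "\<forall>e>0. \<exists>S\<in>compact_operators. dist S T < e"
    by (simp add: closure_approachable)
  have "\<exists>k. finite k \<and> blinfun_apply T ` cball 0 1 \<subseteq> (\<Union>x\<in>k. ball x e)" if "e > 0" for e
  proof -
    obtain S where S: "S \<in> compact_operators" "dist S T < e/2"
      using T \<open>e > 0\<close> half_gt_zero by blast
    then obtain k where k: "finite k" "blinfun_apply S ` cball 0 1 \<subseteq> (\<Union>x\<in>k. ball x (e/2))"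
      using \<open>e > 0\<close> compact_operators_totally_bounded_iff[of S] by (meson half_gt_zero)
    have "blinfun_apply T x \<in> (\<Union>x\<in>k. ball x e)" if x: "x \<in> cball 0 1" for x
    proof -
      obtain y where y: "y \<in> k" "dist y (S x) < e/2"
        using subsetD[OF k(2) imageI[OF x]] by auto
      have "dist (S x) (T x) \<le> norm (S - T) * norm x"
        by (metis dist_norm minus_blinfun.rep_eq norm_blinfun)
      also have "\<dots> \<le> norm (S - T)" using x by (simp add: mult_left_le)
      finally have "dist (S x) (T x) < e/2" using S(2) by (simp add: dist_norm)
      then have "dist y (T x) < e" using y(2) dist_triangle[of y "T x" "S x"] by simp
      then show ?thesis using y(1) by auto
    qed
    then show ?thesis using k(1) by blast
  qed
  then show "T \<in> compact_operators" by (simp add: compact_operators_totally_bounded_iff)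
qed

text \<open>
  For scalar-valued maps, the strong operator topology is the topology of pointwise convergence on
  the dual space, which is the weak* topology.
\<close>

abbreviation weak_star_topology :: "('a::real_normed_vector \<Rightarrow>\<^sub>L real) topology" where
  "weak_star_topology \<equiv> strong_operator_topology"

lemma limitin_weak_star_iff:
  "limitin weak_star_topology f l F \<longleftrightarrow> (\<forall>y. ((\<lambda>n. blinfun_apply (f n) y) \<longlongrightarrow> blinfun_apply l y) F)"
proof -
  have "limitin weak_star_topology f l F \<longleftrightarrow>
        limitin euclidean (\<lambda>n. blinfun_apply (f n)) (blinfun_apply l) F"
    unfolding strong_operator_topology_def limitin_def topspace_pullback_topology
    by (auto simp: openin_pullback_topology)
  also have "\<dots> \<longleftrightarrow> (\<forall>y. ((\<lambda>n. blinfun_apply (f n) y) \<longlongrightarrow> blinfun_apply l y) F)"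
    unfolding euclidean_product_topology[symmetric] limitin_componentwise by simp
  finally show ?thesis .
qed

end

theory Submission
  imports Defs
begin

text \<open>
  Write \<open>X\<close> for the domain \<open>'a\<close> and \<open>Y\<close> for the range \<open>'b\<close>. The idea is that \<open>Y\<close> itself already
  contains \<open>c\<^sub>0\<close> as a complemented subspace, and that \<open>Y\<close> is complemented in \<open>K(X,Y)\<close> by rank-one
  operators, so that the two complementations compose.

  For the first part let \<open>f : G \<rightarrow> c\<^sub>0\<close> be an isomorphism of a subspace \<open>G\<close> of \<open>Y\<close>. The coordinates
  of \<open>f\<close> are uniformly bounded functionals on \<open>G\<close>; by Hahn--Banach they extend to a bounded sequence
  \<open>\<Phi>\<^sub>n\<close> in \<open>Y\<^sup>*\<close>. A subsequence \<open>\<Phi>\<^bsub>r k\<^esub>\<close> converges weak* to some \<open>l\<close>, and \<open>l\<close> vanishes on \<open>G\<close> because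
  the coordinates of an element of \<open>c\<^sub>0\<close> tend to zero. Hence \<open>\<psi>\<^sub>k = \<Phi>\<^bsub>r k\<^esub> - l\<close> is weak* null and bounded,
  so \<open>y \<mapsto> (\<psi>\<^sub>k y)\<^sub>k\<close> maps all of \<open>Y\<close> continuously into \<open>c\<^sub>0\<close>, while on \<open>G\<close> it still reads off the
  coordinates with indices in the range of \<open>r\<close>. Placing a null sequence at these indices, with
  zeros elsewhere, and applying the inverse of \<open>f\<close> gives a right inverse
  (\<open>c0_retract_of_weak_star_compact\<close>).

  For the second part choose \<open>x\<^sub>0 \<in> X\<close> and \<open>\<phi> \<in> X\<^sup>*\<close> with \<open>\<phi> x\<^sub>0 = 1\<close>. Then \<open>y \<mapsto> \<phi>(\<cdot>) y\<close> maps \<open>Y\<close> into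
  \<open>K(X,Y)\<close>, and evaluation at \<open>x\<^sub>0\<close> undoes it (\<open>range_space_retract_of_compact_operators\<close>).
\<close>

section \<open>Linear maps on subspaces\<close>

lemma linear_map_on_zero:
  assumes "subspace S" "linear_map_on S f"
  shows "f 0 = 0"
proof -
  have "f (0 *\<^sub>R 0) = 0 *\<^sub>R f 0"
    using assms subspace_0 unfolding linear_map_on_def by blast
  then show ?thesis by simp
qed

lemma linear_map_on_diff:
  assumes "subspace S" "linear_map_on S f" "x \<in> S" "y \<in> S"
  shows "f (x - y) = f x - f y"
proof -
  have "f (x + (- 1) *\<^sub>R y) = f x + (- 1) *\<^sub>R f y"
    using assms subspace_scale[of S y "- 1"] unfolding linear_map_on_def by metis
  then show ?thesis by simp
qed

lemma linear_map_on_compose: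
  assumes "linear_map_on S f" "f ` S \<subseteq> T" "linear_map_on T g"
  shows "linear_map_on S (g \<circ> f)"
  using assms by (auto simp: linear_map_on_def image_subset_iff)

lemma linear_map_on_continuous_bound:
  fixes f :: "'a::real_normed_vector \<Rightarrow> 'b::real_normed_vector"
  assumes S: "subspace S" and f: "linear_map_on S f" and cont: "continuous_on S f"
  shows "\<exists>B\<ge>0. \<forall>x\<in>S. norm (f x) \<le> B * norm x"
proof -
  have f0: "f 0 = 0" using linear_map_on_zero[OF S f] .
  obtain d where d: "d > 0" "\<And>x. x \<in> S \<Longrightarrow> norm x < d \<Longrightarrow> norm (f x) < 1"
    using cont subspace_0[OF S] f0 unfolding continuous_on_iff
    by (metis dist_0_norm dist_commute zero_less_one)
  have "norm (f x) \<le> (2 / d) * norm x" if x: "x \<in> S" for x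
  proof (cases "x = 0")
    case True
    then show ?thesis using f0 by simp
  next
    case False
    define c where "c = d / (2 * norm x)"
    have c: "c > 0" using d False by (simp add: c_def)
    have "norm (c *\<^sub>R x) < d" using d False by (simp add: c_def)
    then have "norm (f (c *\<^sub>R x)) < 1" using d(2) subspace_scale[OF S x] by blast
    then have "c * norm (f x) < 1"
      using f x c by (simp add: linear_map_on_def)
    then show ?thesis using d False by (simp add: c_def field_simps)
  qed
  then show ?thesis using d(1) by (intro exI[of _ "2 / d"]) auto
qed

lemma linear_map_on_bound_continuous:
  fixes f :: "'a::real_normed_vector \<Rightarrow> 'b::real_normed_vector"
  assumes S: "subspace S" and f: "linear_map_on S f"
    and B: "\<And>x. x \<in> S \<Longrightarrow> norm (f x) \<le> B * norm x"
  shows "continuous_on S f"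
proof -
  have "(\<bar>B\<bar>)-lipschitz_on S f"
  proof (rule lipschitz_onI)
    fix x y assume xy: "x \<in> S" "y \<in> S"
    have "norm (f x - f y) \<le> B * norm (x - y)"
      using B[OF subspace_diff[OF S xy]] linear_map_on_diff[OF S f xy] by simp
    also have "\<dots> \<le> \<bar>B\<bar> * norm (x - y)" by (intro mult_right_mono) auto
    finally show "dist (f x) (f y) \<le> \<bar>B\<bar> * dist x y" by (simp add: dist_norm)
  qed simp
  then show ?thesis by (rule lipschitz_on_continuous_on)
qed

lemma bounded_linear_imp_linear_map_on: "bounded_linear f \<Longrightarrow> linear_map_on S f"
  by (simp add: linear_map_on_def bounded_linear.linear linear_add linear_scale)

section \<open>The Hahn--Banach theorem\<close>

text \<open>
  The one-dimensional extension step, in which \<open>M\<close> is the graph of a functional dominated by \<open>p\<close>.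
  A value \<open>c\<close> at a new point \<open>z\<close> is admissible if it lies between the numbers \<open>a - p (x - z)\<close> and the
  numbers \<open>p (y + z) - b\<close>, where \<open>(x, a)\<close> and \<open>(y, b)\<close> range over \<open>M\<close>; subadditivity of \<open>p\<close> makes room
  for such a \<open>c\<close>.
\<close>

lemma hahn_banach_maximal_total:
  fixes M :: "('a::real_vector \<times> real) set" and p :: "'a \<Rightarrow> real"
  assumes p_add: "\<And>x y. p (x + y) \<le> p x + p y"
    and p_scale: "\<And>c x. c > 0 \<Longrightarrow> p (c *\<^sub>R x) = c * p x"
    and M: "subspace M" "\<And>x a. (x, a) \<in> M \<Longrightarrow> a \<le> p x"
    and max: "\<And>N. subspace N \<Longrightarrow> (\<And>x a. (x, a) \<in> N \<Longrightarrow> a \<le> p x) \<Longrightarrow> M \<subseteq> N \<Longrightarrow> N = M"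
  shows "\<exists>c. (z, c) \<in> M"
proof -
  let ?L = "(\<lambda>(x, a). a - p (x - z)) ` M"
  have sep: "a - p (x - z) \<le> p (y + z) - b" if "(x, a) \<in> M" "(y, b) \<in> M" for x a y b
  proof -
    have "a + b \<le> p (x + y)"
      using M(2) subspace_add[OF M(1) that] by simp
    also have "\<dots> \<le> p (x - z) + p (y + z)"
      using p_add[of "x - z" "y + z"] by (simp add: algebra_simps)
    finally show ?thesis by simp
  qed
  have 0: "(0, 0) \<in> M"
    using subspace_0[OF M(1)] by (simp add: zero_prod_def)
  define c where "c = Sup ?L"
  have bdd: "bdd_above ?L"
    using sep[OF _ 0] by (intro bdd_aboveI[of _ "p (0 + z) - 0"]) auto
  have lower: "a - p (x - z) \<le> c" if "(x, a) \<in> M" for x a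
    unfolding c_def using bdd that by (intro cSup_upper) force+
  have upper: "c \<le> p (y + z) - b" if "(y, b) \<in> M" for y b
    unfolding c_def using 0 sep[OF _ that] by (intro cSup_least) auto
  let ?N = "span (insert (z, c) M)"
  have "a \<le> p x" if xa: "(x, a) \<in> ?N" for x a
  proof -
    obtain t where t: "(x - t *\<^sub>R z, a - t * c) \<in> M"
      using xa M(1) by (auto simp: span_insert span_eq_iff[THEN iffD2])
    consider "t = 0" | "t > 0" | "t < 0" by linarith
    then show ?thesis
    proof cases
      case 1
      then show ?thesis using t M(2) by simp
    next
      case 2
      have "(inverse t *\<^sub>R (x - t *\<^sub>R z), inverse t * (a - t * c)) \<in> M"
        using subspace_scale[OF M(1) t, of "inverse t"] by simp
      from upper[OF this] have "a / t \<le> p (inverse t *\<^sub>R x)"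
        using 2 by (simp add: algebra_simps divide_inverse)
      then show ?thesis using 2 p_scale[of "inverse t" x] by (simp add: field_simps)
    next
      case 3
      define s where "s = - t"
      have s: "s > 0" using 3 by (simp add: s_def)
      have "(inverse s *\<^sub>R (x - t *\<^sub>R z), inverse s * (a - t * c)) \<in> M"
        using subspace_scale[OF M(1) t, of "inverse s"] by simp
      from lower[OF this] have "a / s \<le> p (inverse s *\<^sub>R x)"
        using s by (simp add: s_def algebra_simps divide_inverse)
      then show ?thesis using s p_scale[of "inverse s" x] by (simp add: field_simps)
    qed
  qed
  then have "?N = M"
    by (intro max subspace_span) (auto intro: span_superset[THEN subsetD])
  then show ?thesis
    by (metis insertI1 span_base)
qed

text \<open>
  Zorn's lemma is applied to graphs. Being the graph of a linear function is expressed by being a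
  subspace of the product that lies below \<open>p\<close>: both a value over \<open>0\<close> and its negative are at most
  \<open>p 0 = 0\<close>, so such a subspace is single-valued. Unions of chains are then immediate.
\<close>

theorem hahn_banach_sublinear:
  fixes G :: "'a::real_vector set" and p f :: "'a \<Rightarrow> real"
  assumes p_add: "\<And>x y. p (x + y) \<le> p x + p y"
    and p_scale: "\<And>c x. c > 0 \<Longrightarrow> p (c *\<^sub>R x) = c * p x"
    and G: "subspace G" and f: "linear_map_on G f" and le: "\<And>x. x \<in> G \<Longrightarrow> f x \<le> p x"
  shows "\<exists>F. linear F \<and> (\<forall>x\<in>G. F x = f x) \<and> (\<forall>x. F x \<le> p x)"
proof -
  let ?graph = "(\<lambda>x. (x, f x)) ` G"
  define A where "A = {M. subspace M \<and> (\<forall>(x, a)\<in>M. a \<le> p x) \<and> ?graph \<subseteq> M}"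
  have f0: "f 0 = 0" by (rule linear_map_on_zero[OF G f])
  have "subspace ?graph"
  proof (rule subspaceI)
    show "0 \<in> ?graph"
      using f0 subspace_0[OF G] by (force simp: zero_prod_def)
  next
    fix u v assume "u \<in> ?graph" "v \<in> ?graph"
    then obtain x y where "x \<in> G" "y \<in> G" "u = (x, f x)" "v = (y, f y)" by blast
    moreover from this have "f (x + y) = f x + f y" "x + y \<in> G"
      using f subspace_add[OF G] by (auto simp: linear_map_on_def)
    ultimately show "u + v \<in> ?graph" by (auto intro!: image_eqI[of _ _ "x + y"])
  next
    fix c u assume "u \<in> ?graph"
    then obtain x where "x \<in> G" "u = (x, f x)" by blast
    moreover from this have "f (c *\<^sub>R x) = c *\<^sub>R f x" "c *\<^sub>R x \<in> G"
      using f subspace_scale[OF G] by (auto simp: linear_map_on_def)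
    ultimately show "c *\<^sub>R u \<in> ?graph" by (auto intro!: image_eqI[of _ _ "c *\<^sub>R x"])
  qed
  then have "?graph \<in> A"
    using le by (auto simp: A_def)
  then have "A \<noteq> {}" by blast
  moreover have "\<Union>C \<in> A" if C: "C \<noteq> {}" "subset.chain A C" for C
  proof -
    have CA: "\<And>M. M \<in> C \<Longrightarrow> M \<in> A"
      and tot: "\<And>M N. M \<in> C \<Longrightarrow> N \<in> C \<Longrightarrow> M \<subseteq> N \<or> N \<subseteq> M"
      using C(2) by (auto simp: subset_chain_def)
    have sub: "\<And>M. M \<in> C \<Longrightarrow> subspace M"
      using CA by (auto simp: A_def)
    have "subspace (\<Union>C)"
    proof (rule subspaceI)
      show "0 \<in> \<Union>C" using C(1) sub subspace_0 by blast
      show "u + v \<in> \<Union>C" if uv: "u \<in> \<Union>C" "v \<in> \<Union>C" for u v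
      proof -
        obtain M N where MN: "M \<in> C" "u \<in> M" "N \<in> C" "v \<in> N" using uv by blast
        from tot[OF MN(1,3)] show ?thesis
        proof
          assume "M \<subseteq> N"
          then show ?thesis using MN subspace_add[OF sub[OF MN(3)], of u v] by blast
        next
          assume "N \<subseteq> M"
          then show ?thesis using MN subspace_add[OF sub[OF MN(1)], of u v] by blast
        qed
      qed
      show "c *\<^sub>R u \<in> \<Union>C" if "u \<in> \<Union>C" for c u
        using that sub subspace_scale by blast
    qed
    moreover have "?graph \<subseteq> \<Union>C"
      using C(1) CA unfolding A_def by blast
    moreover have "\<forall>(x, a)\<in>\<Union>C. a \<le> p x"
      using CA unfolding A_def by fastforce
    ultimately show ?thesis by (simp add: A_def)
  qed
  ultimately obtain M where M: "M \<in> A" and max: "\<And>N. N \<in> A \<Longrightarrow> M \<subseteq> N \<Longrightarrow> N = M"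
    using subset_Zorn_nonempty[of A] by blast
  have Ms: "subspace M" and Mp: "\<And>x a. (x, a) \<in> M \<Longrightarrow> a \<le> p x" and Mg: "?graph \<subseteq> M"
    using M by (auto simp: A_def)
  have "\<exists>c. (z, c) \<in> M" for z
  proof (rule hahn_banach_maximal_total[OF p_add p_scale Ms Mp])
    fix N assume "subspace N" "\<And>x a. (x, a) \<in> N \<Longrightarrow> a \<le> p x" "M \<subseteq> N"
    then show "N = M" using Mg by (intro max) (auto simp: A_def)
  qed
  then obtain F where F: "\<And>z. (z, F z) \<in> M" by metis
  have p0: "p 0 = 0" using p_scale[of 2 0] by simp
  \<comment> \<open>The differences of \<open>a\<close> and \<open>b\<close> in both orders are values over \<open>0\<close>, hence at most \<open>p 0 = 0\<close>.\<close>
  have uniq: "a = b" if "(x, a) \<in> M" "(x, b) \<in> M" for x a b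
    using Mp[of 0 "a - b"] Mp[of 0 "b - a"] subspace_diff[OF Ms that]
      subspace_diff[OF Ms that(2,1)] p0 by simp
  have "linear F"
  proof (rule linearI)
    show "F (x + y) = F x + F y" for x y
      using uniq[OF F] subspace_add[OF Ms F F, of x y] by simp
    show "F (c *\<^sub>R x) = c *\<^sub>R F x" for c x
      using uniq[OF F] subspace_scale[OF Ms F, of c x] by simp
  qed
  moreover have "F x = f x" if "x \<in> G" for x
    using uniq[OF F] Mg that by blast
  ultimately show ?thesis using Mp F by blast
qed

corollary hahn_banach_norm:
  fixes G :: "'a::real_normed_vector set" and f :: "'a \<Rightarrow> real"
  assumes G: "subspace G" and f: "linear_map_on G f"
    and le: "\<And>x. x \<in> G \<Longrightarrow> \<bar>f x\<bar> \<le> B * norm x" and B: "B \<ge> 0"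
  shows "\<exists>F :: 'a \<Rightarrow>\<^sub>L real. (\<forall>x\<in>G. blinfun_apply F x = f x) \<and> norm F \<le> B"
proof -
  have "\<exists>F. linear F \<and> (\<forall>x\<in>G. F x = f x) \<and> (\<forall>x. F x \<le> B * norm x)"
  proof (rule hahn_banach_sublinear[OF _ _ G f])
    show "B * norm (x + y) \<le> B * norm x + B * norm y" for x y :: 'a
      using B norm_triangle_ineq[of x y] mult_left_mono by (metis distrib_left)
    show "f x \<le> B * norm x" if "x \<in> G" for x using le[OF that] by simp
  qed simp
  then obtain F where F: "linear F" "\<And>x. x \<in> G \<Longrightarrow> F x = f x" "\<And>x. F x \<le> B * norm x"
    by blast
  have abs: "\<bar>F x\<bar> \<le> B * norm x" for x
    using F(3)[of x] F(3)[of "- x"] linear_neg[OF F(1), of x] by simp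
  then have "bounded_linear F"
    using linear_add[OF F(1)] linear_scale[OF F(1)]
    by (intro bounded_linear_intro[of _ B]) (simp_all add: mult.commute)
  then have "blinfun_apply (Blinfun F) = F" by (rule bounded_linear_Blinfun_apply)
  then show ?thesis
    using F(2) abs B by (intro exI[of _ "Blinfun F"]) (auto intro: norm_blinfun_bound)
qed

corollary exists_functional_eq_one:
  fixes x0 :: "'a::real_normed_vector"
  assumes "x0 \<noteq> 0"
  shows "\<exists>\<phi> :: 'a \<Rightarrow>\<^sub>L real. blinfun_apply \<phi> x0 = 1"
proof -
  define f where "f x = (THE t. x = t *\<^sub>R x0)" for x
  have f: "f (t *\<^sub>R x0) = t" for t
    unfolding f_def using assms by (intro the_equality) auto
  have sp: "span {x0} = range (\<lambda>t. t *\<^sub>R x0)" by (rule span_singleton)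
  have "linear_map_on (span {x0}) f"
    unfolding linear_map_on_def sp
    by (auto simp: f simp flip: scaleR_add_left)
  moreover have "\<bar>f x\<bar> \<le> inverse (norm x0) * norm x" if "x \<in> span {x0}" for x
    using that assms unfolding sp by (auto simp: f field_simps)
  ultimately obtain \<phi> :: "'a \<Rightarrow>\<^sub>L real" where "\<forall>x\<in>span {x0}. blinfun_apply \<phi> x = f x"
    using hahn_banach_norm[OF subspace_span, of "{x0}" f "inverse (norm x0)"] by auto
  then show ?thesis using f[of 1] span_base[of x0 "{x0}"] by (intro exI[of _ \<phi>]) auto
qed

section \<open>Linear retracts\<close>

text \<open>
  The identity of \<open>F\<close> factors through \<open>E\<close>. Unlike complemented copies, whose projections and
  homeomorphisms would have to be carried along, such factorizations compose directly.
\<close>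

definition linear_retract ::
    "'a::real_normed_vector set \<Rightarrow> 'b::real_normed_vector set \<Rightarrow> bool" where
  "linear_retract E F \<longleftrightarrow>
     (\<exists>S Q. linear_map_on F S \<and> continuous_on F S \<and> S ` F \<subseteq> E \<and>
            linear_map_on E Q \<and> continuous_on E Q \<and> Q ` E \<subseteq> F \<and> (\<forall>x\<in>F. Q (S x) = x))"

lemma linear_retract_trans:
  assumes "linear_retract E F" "linear_retract F H"
  shows "linear_retract E H"
proof -
  obtain S Q where 1: "linear_map_on F S" "continuous_on F S" "S ` F \<subseteq> E"
      "linear_map_on E Q" "continuous_on E Q" "Q ` E \<subseteq> F" "\<forall>x\<in>F. Q (S x) = x"
    using assms(1) unfolding linear_retract_def by blast
  obtain S' Q' where 2: "linear_map_on H S'" "continuous_on H S'" "S' ` H \<subseteq> F"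
      "linear_map_on F Q'" "continuous_on F Q'" "Q' ` F \<subseteq> H" "\<forall>x\<in>H. Q' (S' x) = x"
    using assms(2) unfolding linear_retract_def by blast
  show ?thesis
    unfolding linear_retract_def
  proof (intro exI conjI)
    show "linear_map_on H (S \<circ> S')" using 1 2 by (blast intro: linear_map_on_compose)
    show "linear_map_on E (Q' \<circ> Q)" using 1 2 by (blast intro: linear_map_on_compose)
    show "continuous_on H (S \<circ> S')" 
      by (rule continuous_on_compose[OF 2(2) continuous_on_subset[OF 1(2) 2(3)]])
    show "continuous_on E (Q' \<circ> Q)" 
      by (rule continuous_on_compose[OF 1(5) continuous_on_subset[OF 2(5) 1(6)]])
  qed (use 1 2 in \<open>auto simp: image_subset_iff\<close>)
qed

text \<open>
  The copy is the image of the section \<open>S\<close> and the projection is \<open>S \<circ> Q\<close>; the image is closed in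
  \<open>E\<close> because it is the fixed-point set of this continuous map.
\<close>

lemma linear_retract_imp_complemented_copy:
  assumes F: "subspace F" and retract: "linear_retract E F"
  shows "contains_complemented_copy E F"
proof -
  obtain S Q where S: "linear_map_on F S" "continuous_on F S" "S ` F \<subseteq> E"
      and Q: "linear_map_on E Q" "continuous_on E Q" "Q ` E \<subseteq> F"
      and QS_ball: "\<forall>x\<in>F. Q (S x) = x"
    using retract unfolding linear_retract_def by blast
  have QS: "Q (S x) = x" if "x \<in> F" for x using QS_ball that by blast
  have contP: "continuous_on E (S \<circ> Q)"
    by (rule continuous_on_compose[OF Q(2) continuous_on_subset[OF S(2) Q(3)]])
  have range: "S ` F = {x \<in> E. (S \<circ> Q) x - x = 0}"
    using S(3) Q(3) QS by force
  show ?thesis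
    unfolding contains_complemented_copy_def
  proof (intro exI conjI)
    show "subspace (S ` F)"
    proof (rule subspaceI)
      show "0 \<in> S ` F"
        using linear_map_on_zero[OF F S(1)] subspace_0[OF F] by force
      show "u + v \<in> S ` F" if "u \<in> S ` F" "v \<in> S ` F" for u v
        using that S(1) subspace_add[OF F]
        unfolding linear_map_on_def by (metis (no_types, lifting) imageE imageI)
      show "c *\<^sub>R u \<in> S ` F" if "u \<in> S ` F" for c u
        using that S(1) subspace_scale[OF F]
        unfolding linear_map_on_def by (metis (no_types, lifting) imageE imageI)
    qed
    show "closedin (top_of_set E) (S ` F)"
      unfolding range
      by (intro continuous_closedin_preimage_constant continuous_on_diff contP continuous_on_id)
    show "linearly_homeomorphic (S ` F) F"
      unfolding linearly_homeomorphic_def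
    proof (intro exI conjI)
      show "linear_map_on (S ` F) Q"
        using Q(1) S(3) by (auto simp: linear_map_on_def image_subset_iff)
      show "homeomorphism (S ` F) F Q S"
        using S Q QS by (auto simp: homeomorphism_def image_image intro: continuous_on_subset)
    qed
    show "linear_map_on E (S \<circ> Q)"
      using Q(1,3) S(1) by (rule linear_map_on_compose)
    show "continuous_on E (S \<circ> Q)" by (rule contP)
    show "(S \<circ> Q) ` E = S ` F"
      using S(3) Q(3) QS by (force simp: image_comp[symmetric])
    show "\<forall>x\<in>E. (S \<circ> Q) ((S \<circ> Q) x) = (S \<circ> Q) x"
      using Q(3) QS by (auto simp: image_subset_iff)
  qed
qed

section \<open>Maps into the space of null sequences\<close>

lemma null_sequence_bcontfun:
  fixes a :: "nat \<Rightarrow> real"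
  assumes "a \<longlonglongrightarrow> 0"
  shows "apply_bcontfun (Bcontfun a) = a" "Bcontfun a \<in> c0"
proof -
  have "bounded (range a)"
    using assms convergent_imp_bounded by blast
  then have "a \<in> bcontfun" by (simp add: bcontfun_def)
  then show "apply_bcontfun (Bcontfun a) = a" by (rule Bcontfun_inverse)
  then show "Bcontfun a \<in> c0" using assms by (simp add: c0_def)
qed

lemma pointwise_null_functionals_into_c0:
  fixes \<psi> :: "nat \<Rightarrow> 'a::real_normed_vector \<Rightarrow> real"
  assumes E: "subspace E" and lin: "\<And>k. linear_map_on E (\<psi> k)"
    and bound: "\<And>k x. x \<in> E \<Longrightarrow> \<bar>\<psi> k x\<bar> \<le> B * norm x"
    and null: "\<And>x. x \<in> E \<Longrightarrow> (\<lambda>k. \<psi> k x) \<longlonglongrightarrow> 0"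
  defines "\<Psi> \<equiv> \<lambda>x. Bcontfun (\<lambda>k. \<psi> k x)"
  shows "linear_map_on E \<Psi>" "continuous_on E \<Psi>" "\<Psi> ` E \<subseteq> c0"
    "\<And>x k. x \<in> E \<Longrightarrow> \<Psi> x k = \<psi> k x"
proof -
  show val: "\<Psi> x k = \<psi> k x" if "x \<in> E" for x k
    using null_sequence_bcontfun(1)[OF null[OF that]] by (simp add: \<Psi>_def)
  show "\<Psi> ` E \<subseteq> c0"
    using null_sequence_bcontfun(2)[OF null] by (auto simp: \<Psi>_def)
  show linear: "linear_map_on E \<Psi>"
    unfolding linear_map_on_def
  proof (intro conjI ballI allI bcontfun_eqI)
    fix x y k assume "x \<in> E" "y \<in> E"
    then show "\<Psi> (x + y) k = (\<Psi> x + \<Psi> y) k"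
      using lin[of k] subspace_add[OF E] by (simp add: val linear_map_on_def)
  next
    fix c x k assume "x \<in> E"
    then show "\<Psi> (c *\<^sub>R x) k = (c *\<^sub>R \<Psi> x) k"
      using lin[of k] subspace_scale[OF E] by (simp add: val linear_map_on_def)
  qed
  show "continuous_on E \<Psi>"
  proof (rule linear_map_on_bound_continuous[OF E linear])
    show "norm (\<Psi> x) \<le> B * norm x" if "x \<in> E" for x
      using bound[OF that] val[OF that] by (intro norm_bound) simp
  qed
qed

text \<open>
  The section places a null sequence at the indices \<open>r 0\<close>, \<open>r 1\<close>, \<dots> and fills up with zeros; it
  makes up for the coordinates that are lost in passing to a subsequence.
\<close>

lemma c0_right_inverse_of_subsequence:
  fixes r :: "nat \<Rightarrow> nat"
  assumes r: "strict_mono r"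
  shows "\<exists>S. linear_map_on c0 S \<and> continuous_on c0 S \<and> S ` c0 \<subseteq> c0 \<and>
             (\<forall>x\<in>c0. \<forall>k. apply_bcontfun (S x) (r k) = x k)"
proof -
  define \<psi> :: "nat \<Rightarrow> (nat \<Rightarrow>\<^sub>C real) \<Rightarrow> real"
    where "\<psi> m x = (if m \<in> range r then x (inv r m) else 0)" for m x
  have inj: "inj r" using r by (rule strict_mono_imp_inj_on)
  have lin: "linear_map_on c0 (\<psi> m)" for m
    by (simp add: linear_map_on_def \<psi>_def)
  have bound: "\<bar>\<psi> m x\<bar> \<le> 1 * norm x" for m x
    using norm_bounded[of x "inv r m"] by (simp add: \<psi>_def)
  have null: "(\<lambda>m. \<psi> m x) \<longlonglongrightarrow> 0" if x: "x \<in> c0" for x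
  proof (rule LIMSEQ_I)
    fix e :: real assume e: "e > 0"
    have "x \<longlonglongrightarrow> 0" using x by (simp add: c0_def)
    then obtain N where N: "\<forall>k\<ge>N. norm (x k - 0) < e"
      using LIMSEQ_D[OF _ e] by blast
    have "norm (\<psi> m x - 0) < e" if m: "m \<ge> r N" for m
    proof (cases "m \<in> range r")
      case True
      then obtain k where k: "m = r k" by blast
      then have "k \<ge> N" using m r by (simp add: strict_mono_less_eq)
      then show ?thesis using N k inj by (simp add: \<psi>_def)
    qed (simp add: \<psi>_def e)
    then show "\<exists>M. \<forall>m\<ge>M. norm (\<psi> m x - 0) < e" by blast
  qed
  note S = pointwise_null_functionals_into_c0[OF subspace_c0 lin bound null]
  have "\<forall>x\<in>c0. \<forall>k. apply_bcontfun (Bcontfun (\<lambda>m. \<psi> m x)) (r k) = x k"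
    using S(4) inj by (simp add: \<psi>_def)
  then show ?thesis using S(1-3) by blast
qed

section \<open>Complementing the copy of the null sequences\<close>

text \<open>
  Extending the coordinates of the copy by Hahn--Banach only gives a bounded map of the whole space
  into the bounded sequences. Keeping a weak* convergent subsequence of the extensions and
  subtracting its limit, which vanishes on the copy, brings the values into \<open>c\<^sub>0\<close> without changing
  the coordinates that were kept.
\<close>

lemma c0_retract_of_weak_star_compact:
  assumes copy: "contains_copy (UNIV :: 'b::real_normed_vector set) c0"
    and seq: "\<And>f :: nat \<Rightarrow> ('b \<Rightarrow>\<^sub>L real). bounded (range f) \<Longrightarrow>
           \<exists>r l. strict_mono r \<and> limitin weak_star_topology (f \<circ> r) l sequentially"
  shows "linear_retract (UNIV :: 'b set) c0"
proof -
  obtain G :: "'b set" and f g where G: "subspace G" and f: "linear_map_on G f"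
      and hom: "homeomorphism G c0 f g"
    using copy unfolding contains_copy_def linearly_homeomorphic_def by blast
  have cont: "continuous_on G f" "continuous_on c0 g" and img: "f ` G = c0" "g ` c0 = G"
    and fg: "\<And>a. a \<in> c0 \<Longrightarrow> f (g a) = a" and gf: "\<And>y. y \<in> G \<Longrightarrow> g (f y) = y"
    using hom by (auto simp: homeomorphism_def)
  have g: "linear_map_on c0 g"
    unfolding linear_map_on_def
  proof (intro conjI ballI allI)
    fix a b assume "a \<in> c0" "b \<in> c0"
    then show "g (a + b) = g a + g b"
      using f fg gf[of "g a + g b"] img(2) subspace_add[OF G, of "g a" "g b"]
      unfolding linear_map_on_def by (metis imageI)
  next
    fix c a assume "a \<in> c0"
    then show "g (c *\<^sub>R a) = c *\<^sub>R g a"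
      using f fg gf[of "c *\<^sub>R g a"] img(2) subspace_scale[OF G, of "g a" c]
      unfolding linear_map_on_def by (metis imageI)
  qed
  obtain N where N: "N \<ge> 0" "\<And>y. y \<in> G \<Longrightarrow> norm (f y) \<le> N * norm y"
    using linear_map_on_continuous_bound[OF G f cont(1)] by blast
  have "\<exists>F :: 'b \<Rightarrow>\<^sub>L real. (\<forall>y\<in>G. blinfun_apply F y = f y n) \<and> norm F \<le> N" for n
  proof (rule hahn_banach_norm[OF G _ _ N(1)])
    show "linear_map_on G (\<lambda>y. f y n)" using f by (simp add: linear_map_on_def)
    show "\<bar>f y n\<bar> \<le> N * norm y" if "y \<in> G" for y
      using norm_bounded[of "f y" n] N(2)[OF that] by simp
  qed
  then obtain \<Phi> :: "nat \<Rightarrow> 'b \<Rightarrow>\<^sub>L real"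
    where \<Phi>: "\<And>n y. y \<in> G \<Longrightarrow> blinfun_apply (\<Phi> n) y = f y n" "\<And>n. norm (\<Phi> n) \<le> N"
    by metis
  then have "bounded (range \<Phi>)" by (auto simp: bounded_iff)
  then obtain r l where r: "strict_mono r"
      and "limitin weak_star_topology (\<Phi> \<circ> r) l sequentially"
    using seq by blast
  then have lim: "(\<lambda>k. \<Phi> (r k) y) \<longlonglongrightarrow> l y" for y
    by (simp add: limitin_weak_star_iff)
  have l0: "l y = 0" if y: "y \<in> G" for y
  proof (rule LIMSEQ_unique[OF lim])
    have "f y \<in> c0" using img(1) y by blast
    then have "f y \<longlonglongrightarrow> 0" by (simp add: c0_def)
    then show "(\<lambda>k. \<Phi> (r k) y) \<longlonglongrightarrow> 0"
      using LIMSEQ_subseq_LIMSEQ[OF _ r] \<Phi>(1)[OF y] by (simp add: comp_def)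
  qed
  define \<psi> where "\<psi> k y = \<Phi> (r k) y - l y" for k y
  have lin: "linear_map_on UNIV (\<psi> k)" for k
    by (simp add: linear_map_on_def \<psi>_def blinfun.add_right blinfun.scaleR_right algebra_simps)
  have bound: "\<bar>\<psi> k y\<bar> \<le> (N + norm l) * norm y" for k y
  proof -
    have "\<bar>\<Phi> (r k) y\<bar> \<le> N * norm y"
      using norm_blinfun[of "\<Phi> (r k)" y] mult_right_mono[OF \<Phi>(2)[of "r k"] norm_ge_zero[of y]]
      by simp
    then show ?thesis
      using norm_blinfun[of l y] by (simp add: \<psi>_def distrib_right)
  qed
  have null: "(\<lambda>k. \<psi> k y) \<longlonglongrightarrow> 0" for y
    using lim[of y] by (simp add: \<psi>_def LIM_zero)
  note Q = pointwise_null_functionals_into_c0[OF subspace_UNIV lin bound null]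
  obtain S where S: "linear_map_on c0 S" "continuous_on c0 S" "S ` c0 \<subseteq> c0"
      "\<And>x k. x \<in> c0 \<Longrightarrow> apply_bcontfun (S x) (r k) = x k"
    using c0_right_inverse_of_subsequence[OF r] by blast
  show ?thesis
    unfolding linear_retract_def
  proof (intro exI conjI ballI)
    show "linear_map_on c0 (g \<circ> S)" using S g by (blast intro: linear_map_on_compose)
    show "continuous_on c0 (g \<circ> S)"
      by (rule continuous_on_compose[OF S(2) continuous_on_subset[OF cont(2) S(3)]])
    fix x assume x: "x \<in> c0"
    then have Sx: "S x \<in> c0" using S(3) by blast
    then have "g (S x) \<in> G" using img(2) by blast
    then show "Bcontfun (\<lambda>k. \<psi> k ((g \<circ> S) x)) = x"
      using S(4)[OF x] l0 \<Phi>(1) fg[OF Sx] by (intro bcontfun_eqI) (simp only: Q(4) UNIV_I, simp add: \<psi>_def)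
  qed (use Q(1-3) in auto)
qed

section \<open>The range space inside the compact operators\<close>

lemma rank_one_compact:
  fixes \<phi> :: "'a::real_normed_vector \<Rightarrow>\<^sub>L real" and y :: "'b::real_normed_vector"
  shows "blinfun_scaleR_left y o\<^sub>L \<phi> \<in> compact_operators"
proof -
  let ?K = "(\<lambda>t. t *\<^sub>R y) ` {- norm \<phi>..norm \<phi>}"
  have K: "compact ?K"
    by (intro compact_continuous_image continuous_intros compact_Icc)
  have "blinfun_apply (blinfun_scaleR_left y o\<^sub>L \<phi>) ` cball 0 1 \<subseteq> ?K"
  proof (rule image_subsetI)
    fix x :: 'a assume "x \<in> cball 0 1"
    then have "norm \<phi> * norm x \<le> norm \<phi>" by (simp add: mult_left_le)
    then have "\<bar>\<phi> x\<bar> \<le> norm \<phi>" using norm_blinfun[of \<phi> x] by simp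
    then have "\<phi> x \<in> {- norm \<phi>..norm \<phi>}" by auto
    then show "blinfun_apply (blinfun_scaleR_left y o\<^sub>L \<phi>) x \<in> ?K"
      by (intro image_eqI[of _ _ "\<phi> x"]) simp_all
  qed
  then have "closure (blinfun_apply (blinfun_scaleR_left y o\<^sub>L \<phi>) ` cball 0 1) \<subseteq> ?K"
    by (rule closure_minimal) (rule compact_imp_closed[OF K])
  then show ?thesis
    unfolding compact_operators_def mem_Collect_eq
    using compact_Int_closed[OF K closed_closure] by (metis inf_absorb2)
qed

lemma range_space_retract_of_compact_operators:
  fixes x0 :: "'a::real_normed_vector"
  assumes "x0 \<noteq> 0"
  shows "linear_retract (compact_operators :: ('a \<Rightarrow>\<^sub>L 'b::real_normed_vector) set) (UNIV :: 'b set)"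
proof -
  obtain \<phi> :: "'a \<Rightarrow>\<^sub>L real" where \<phi>: "blinfun_apply \<phi> x0 = 1"
    using exists_functional_eq_one[OF assms] by blast
  have S: "bounded_linear (\<lambda>y :: 'b. blinfun_scaleR_left y o\<^sub>L \<phi>)"
    by (intro bounded_linear_intros)
  have Q: "bounded_linear (\<lambda>T :: 'a \<Rightarrow>\<^sub>L 'b. T x0)"
    by (intro bounded_linear_intros)
  show ?thesis
    unfolding linear_retract_def
  proof (intro exI conjI)
    show "(\<lambda>y :: 'b. blinfun_scaleR_left y o\<^sub>L \<phi>) ` UNIV \<subseteq> compact_operators"
      using rank_one_compact by blast
    show "\<forall>y\<in>UNIV. blinfun_apply (blinfun_scaleR_left y o\<^sub>L \<phi>) x0 = y"
      using \<phi> by simp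
  qed (use S Q in \<open>auto intro: bounded_linear_imp_linear_map_on linear_continuous_on\<close>)
qed

theorem mainTheorem2:
  assumes "\<nexists>B :: 'a::banach set. finite B \<and> span B = UNIV"
    and "\<nexists>B :: 'b::banach set. finite B \<and> span B = UNIV"
    and "contains_copy (UNIV :: 'b set) c0"
    and "\<And>f :: nat \<Rightarrow> ('b \<Rightarrow>\<^sub>L real). bounded (range f) \<Longrightarrow>
           \<exists>r l. strict_mono r \<and> limitin weak_star_topology (f \<circ> r) l sequentially"
  shows "contains_complemented_copy (compact_operators :: ('a \<Rightarrow>\<^sub>L 'b) set) c0"
proof -
  have "\<exists>x0 :: 'a. x0 \<noteq> 0"
  proof (rule ccontr)
    assume "\<not> ?thesis"
    then have "span {} = (UNIV :: 'a set)" by auto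
    then show False using assms(1) by blast
  qed
  then obtain x0 :: 'a where "x0 \<noteq> 0" by blast
  then have "linear_retract (compact_operators :: ('a \<Rightarrow>\<^sub>L 'b) set) c0"
    using range_space_retract_of_compact_operators c0_retract_of_weak_star_compact[OF assms(3,4)]
    by (blast intro: linear_retract_trans)
  then show ?thesis
    by (rule linear_retract_imp_complemented_copy[OF subspace_c0])
qed

end
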